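(* Let $M$ be a complete ultrametric space with a distinguished point $0$ (not assumed separable). If $\mathcal{F}(M)$ is $1$-complemented in its bidual $\mathcal{F}(M)^{**}$, then $M$ is spherically complete.
   Context: All Banach spaces are real. A metric space $(M,d)$ is ultrametric if $d(x,y)\le\max\{d(x,z),d(z,y)\}$ for all $x,y,z\in M$. Metric spaces are pointed, with distinguished point $0\in M$. $\mathrm{Lip}_0(M)$ is the Banach space of all Lipschitz functions $f\colon M\to\mathbb{R}$ with $f(0)=0$, with norm $\|f\|=\sup\{|f(x)-f(y)|/d(x,y): x,y\in M,\ x\ne y\}$. For $x\in M$ let $\delta_x\in\mathrm{Lip}_0(M)^*$ be $\delta_x(f)=f(x)$. The Lipschitz-free space $\mathcal{F}(M)$ is the closed linear span of $\{\delta_x:x\in M\}$ in $\mathrm{Lip}_0(M)^*$; one has $\mathcal{F}(M)^*=\mathrm{Lip}_0(M)$. A Banach space $X$ is $1$-complemented in its bidual if there is a bounded linear projection of $X^{**}$ onto (the canonical image of) $X$ with norm at most $1$. A sequence of sets $(A_n)$ is nested if $A_{n+1}\subset A_n$ for all $n\in\mathbb{N}$. An ultrametric space is spherically complete if every nested sequence of balls (of positive radius) in it has nonempty intersection. *)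

theory Defs
  imports "HOL-Analysis.Analysis"
begin

section \<open>Pointed metric spaces and \<open>Lip\<^sub>0\<close>\<close>

class pointed_metric_space = metric_space +
  fixes base_point :: 'a

typedef (overloaded) 'a lip0 =
  "{f :: 'a::pointed_metric_space \<Rightarrow> real. (\<exists>L. L-lipschitz_on UNIV f) \<and> f base_point = 0}"
  morphisms lip0_apply Abs_lip0
  by (rule exI[of _ "\<lambda>_. 0"]) (auto intro!: exI[of _ 0] lipschitz_onI)

setup_lifting type_definition_lip0

text \<open>The supremum is taken over all pairs, the diagonal included: since \<^term>\<open>0 / 0 = (0::real)\<close>,
  this adds only the value 0 to the quotients over distinct points, and it makes the norm 0 when
  the space has one point, where \<^term>\<open>Sup {} :: real\<close> would be unspecified.\<close>

definition lipschitz_quotients :: "('a::metric_space \<Rightarrow> real) \<Rightarrow> real set" where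
  "lipschitz_quotients f = {\<bar>f x - f y\<bar> / dist x y | x y. True}"

lemma bdd_above_lipschitz_quotients:
  assumes "L-lipschitz_on UNIV f"
  shows "bdd_above (lipschitz_quotients f)"
proof (rule bdd_aboveI)
  fix q assume "q \<in> lipschitz_quotients f"
  then obtain x y where q: "q = \<bar>f x - f y\<bar> / dist x y"
    by (auto simp: lipschitz_quotients_def)
  show "q \<le> L"
    using lipschitz_onD[OF assms, of x y] lipschitz_on_nonneg[OF assms]
    by (cases "x = y") (auto simp: q divide_le_eq dist_real_def)
qed

lemma lipschitz_quotients_upper:
  assumes "L-lipschitz_on UNIV f"
  shows "\<bar>f x - f y\<bar> \<le> Sup (lipschitz_quotients f) * dist x y"
proof (cases "x = y")
  case False
  have "\<bar>f x - f y\<bar> / dist x y \<le> Sup (lipschitz_quotients f)"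
    by (rule cSup_upper[OF _ bdd_above_lipschitz_quotients[OF assms]])
      (auto simp: lipschitz_quotients_def)
  with False show ?thesis
    by (simp add: divide_le_eq)
qed simp

lemma lipschitz_quotients_least:
  assumes "0 \<le> L" and "\<And>x y. \<bar>f x - f y\<bar> \<le> L * dist x y"
  shows "Sup (lipschitz_quotients f) \<le> L"
proof (rule cSup_least)
  show "lipschitz_quotients f \<noteq> {}"
    by (auto simp: lipschitz_quotients_def)
  fix q assume "q \<in> lipschitz_quotients f"
  then obtain x y where q: "q = \<bar>f x - f y\<bar> / dist x y"
    by (auto simp: lipschitz_quotients_def)
  show "q \<le> L"
    using assms by (cases "x = y") (auto simp: q divide_le_eq)
qed

instantiation lip0 :: (pointed_metric_space) real_normed_vector
begin

lift_definition zero_lip0 :: "'a lip0" is "\<lambda>_. 0"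
  by (auto intro!: exI[of _ 0] lipschitz_onI)

lift_definition plus_lip0 :: "'a lip0 \<Rightarrow> 'a lip0 \<Rightarrow> 'a lip0" is "\<lambda>f g x. f x + g x"
  by (auto intro: lipschitz_on_add)

lift_definition uminus_lip0 :: "'a lip0 \<Rightarrow> 'a lip0" is "\<lambda>f x. - f x"
  by (auto intro: lipschitz_on_minus)

lift_definition minus_lip0 :: "'a lip0 \<Rightarrow> 'a lip0 \<Rightarrow> 'a lip0" is "\<lambda>f g x. f x - g x"
  by (auto intro: lipschitz_on_diff)

lift_definition scaleR_lip0 :: "real \<Rightarrow> 'a lip0 \<Rightarrow> 'a lip0" is "\<lambda>c f x. c *\<^sub>R f x"
  by (auto intro: lipschitz_on_cmult_real)

lift_definition norm_lip0 :: "'a lip0 \<Rightarrow> real" is "\<lambda>f. Sup (lipschitz_quotients f)" .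

definition dist_lip0 :: "'a lip0 \<Rightarrow> 'a lip0 \<Rightarrow> real" where
  "dist_lip0 f g = norm (f - g)"

definition sgn_lip0 :: "'a lip0 \<Rightarrow> 'a lip0" where
  "sgn_lip0 f = inverse (norm f) *\<^sub>R f"

definition uniformity_lip0 :: "('a lip0 \<times> 'a lip0) filter" where
  "uniformity_lip0 = (INF e\<in>{0<..}. principal {(f, g). dist f g < e})"

definition open_lip0 :: "'a lip0 set \<Rightarrow> bool" where
  "open_lip0 S = (\<forall>f\<in>S. \<forall>\<^sub>F (f', g) in uniformity. f' = f \<longrightarrow> g \<in> S)"

lemma lip0_upper: "\<bar>lip0_apply f x - lip0_apply f y\<bar> \<le> norm f * dist x y"
  by transfer (auto intro: lipschitz_quotients_upper)

lemma lip0_least: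
  "0 \<le> L \<Longrightarrow> (\<And>x y. \<bar>lip0_apply f x - lip0_apply f y\<bar> \<le> L * dist x y) \<Longrightarrow> norm f \<le> L"
  by transfer (auto intro: lipschitz_quotients_least)

lemma lip0_norm_nonneg: "0 \<le> norm (f :: 'a lip0)"
proof transfer
  fix f :: "'a \<Rightarrow> real"
  assume "(\<exists>L. L-lipschitz_on UNIV f) \<and> f base_point = 0"
  then obtain L where L: "L-lipschitz_on UNIV f"
    by blast
  have "0 \<in> lipschitz_quotients f"
    by (force simp: lipschitz_quotients_def)
  then show "0 \<le> Sup (lipschitz_quotients f)"
    by (rule cSup_upper[OF _ bdd_above_lipschitz_quotients[OF L]])
qed

lemma lip0_norm_scaleR_le: "norm (c *\<^sub>R f) \<le> \<bar>c\<bar> * norm (f :: 'a lip0)"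
proof (rule lip0_least)
  fix x y
  have "\<bar>lip0_apply (c *\<^sub>R f) x - lip0_apply (c *\<^sub>R f) y\<bar>
      = \<bar>c\<bar> * \<bar>lip0_apply f x - lip0_apply f y\<bar>"
    by (simp add: scaleR_lip0.rep_eq abs_mult flip: right_diff_distrib)
  also have "\<dots> \<le> \<bar>c\<bar> * (norm f * dist x y)"
    by (intro mult_left_mono lip0_upper) simp
  finally show "\<bar>lip0_apply (c *\<^sub>R f) x - lip0_apply (c *\<^sub>R f) y\<bar> \<le> \<bar>c\<bar> * norm f * dist x y"
    by (simp add: mult.assoc)
qed (simp add: lip0_norm_nonneg)

instance
proof
  fix f g h :: "'a lip0" and a b :: real
  show "f + g + h = f + (g + h)" "f + g = g + f" "0 + f = f" "- f + f = 0" "f - g = f + - g"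
    "a *\<^sub>R (f + g) = a *\<^sub>R f + a *\<^sub>R g" "(a + b) *\<^sub>R f = a *\<^sub>R f + b *\<^sub>R f"
    "a *\<^sub>R b *\<^sub>R f = (a * b) *\<^sub>R f" "1 *\<^sub>R f = f"
    by (transfer; auto simp: algebra_simps)+
  show "dist f g = norm (f - g)" "sgn f = inverse (norm f) *\<^sub>R f"
    by (simp_all add: dist_lip0_def sgn_lip0_def)
  show "(uniformity :: ('a lip0 \<times> 'a lip0) filter)
      = (INF e\<in>{0<..}. principal {(f, g). dist f g < e})"
    by (rule uniformity_lip0_def)
  show "open S = (\<forall>f\<in>S. \<forall>\<^sub>F (f', g) in uniformity. f' = f \<longrightarrow> g \<in> S)" for S :: "'a lip0 set"
    by (rule open_lip0_def)
  show "norm f = 0 \<longleftrightarrow> f = 0"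
  proof
    assume "norm f = 0"
    then have "lip0_apply f x = lip0_apply f base_point" for x
      using lip0_upper[of f x base_point] by simp
    then show "f = 0"
      by transfer auto
  next
    assume "f = 0"
    then have "norm f \<le> 0"
      by (intro lip0_least) (auto simp: zero_lip0.rep_eq)
    then show "norm f = 0"
      using lip0_norm_nonneg[of f] by simp
  qed
  show "norm (f + g) \<le> norm f + norm g"
  proof (rule lip0_least)
    show "\<bar>lip0_apply (f + g) x - lip0_apply (f + g) y\<bar> \<le> (norm f + norm g) * dist x y" for x y
      using lip0_upper[of f x y] lip0_upper[of g x y]
      by (simp add: plus_lip0.rep_eq distrib_right)
  qed (simp add: lip0_norm_nonneg)
  show "norm (a *\<^sub>R f) = \<bar>a\<bar> * norm f"
  proof (cases "a = 0")
    case True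
    then show ?thesis
      using lip0_norm_scaleR_le[of a f] lip0_norm_nonneg[of "a *\<^sub>R f"] by simp
  next
    case False
    have "f = inverse a *\<^sub>R a *\<^sub>R f"
      using False by transfer auto
    then have "norm f \<le> \<bar>inverse a\<bar> * norm (a *\<^sub>R f)"
      using lip0_norm_scaleR_le[of "inverse a" "a *\<^sub>R f"] by simp
    then have "\<bar>a\<bar> * norm f \<le> norm (a *\<^sub>R f)"
      using False by (simp add: abs_inverse field_simps)
    with lip0_norm_scaleR_le[of a f] show ?thesis
      by simp
  qed
qed

end


section \<open>The Lipschitz-free space\<close>

lift_definition delta :: "'a::pointed_metric_space \<Rightarrow> 'a lip0 \<Rightarrow>\<^sub>L real" is "\<lambda>x f. lip0_apply f x"
proof (rule bounded_linear_intro)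
  fix x :: 'a and f g :: "'a lip0" and c :: real
  show "lip0_apply (f + g) x = lip0_apply f x + lip0_apply g x"
    by (simp add: plus_lip0.rep_eq)
  show "lip0_apply (c *\<^sub>R f) x = c *\<^sub>R lip0_apply f x"
    by (simp add: scaleR_lip0.rep_eq)
  have "lip0_apply f base_point = 0"
    using lip0_apply[of f] by simp
  then show "norm (lip0_apply f x) \<le> norm f * dist x base_point"
    using lip0_upper[of f x base_point] by simp
qed

lemma subspace_closure_span:
  fixes S :: "'a::real_normed_vector set"
  shows "subspace (closure (span S))"
proof (rule subspaceI)
  show "0 \<in> closure (span S)"
    using closure_subset span_zero by blast
next
  fix x y assume "x \<in> closure (span S)" "y \<in> closure (span S)"
  then obtain u v where "\<And>n. u n \<in> span S" "u \<longlonglongrightarrow> x" "\<And>n. v n \<in> span S" "v \<longlonglongrightarrow> y"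
    by (auto simp: closure_sequential)
  then have "(\<forall>n. u n + v n \<in> span S) \<and> (\<lambda>n. u n + v n) \<longlonglongrightarrow> x + y"
    by (auto intro: span_add tendsto_add)
  then show "x + y \<in> closure (span S)"
    unfolding closure_sequential by (intro exI[of _ "\<lambda>n. u n + v n"])
next
  fix c :: real and x assume "x \<in> closure (span S)"
  then obtain u where "\<And>n. u n \<in> span S" "u \<longlonglongrightarrow> x"
    by (auto simp: closure_sequential)
  then have "(\<forall>n. c *\<^sub>R u n \<in> span S) \<and> (\<lambda>n. c *\<^sub>R u n) \<longlonglongrightarrow> c *\<^sub>R x"
    by (auto intro: span_scale tendsto_intros)
  then show "c *\<^sub>R x \<in> closure (span S)"
    unfolding closure_sequential by (intro exI[of _ "\<lambda>n. c *\<^sub>R u n"])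
qed

typedef (overloaded) 'a lipschitz_free =
  "closure (span (range delta)) :: ('a::pointed_metric_space lip0 \<Rightarrow>\<^sub>L real) set"
  morphisms free_functional Abs_lipschitz_free
  using subspace_0[OF subspace_closure_span] by blast

setup_lifting type_definition_lipschitz_free

instantiation lipschitz_free :: (pointed_metric_space) real_normed_vector
begin

lift_definition zero_lipschitz_free :: "'a lipschitz_free" is 0
  by (rule subspace_0[OF subspace_closure_span])

lift_definition plus_lipschitz_free ::
  "'a lipschitz_free \<Rightarrow> 'a lipschitz_free \<Rightarrow> 'a lipschitz_free" is "(+)"
  by (rule subspace_add[OF subspace_closure_span])

lift_definition uminus_lipschitz_free :: "'a lipschitz_free \<Rightarrow> 'a lipschitz_free" is uminus
  by (rule subspace_neg[OF subspace_closure_span])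

lift_definition minus_lipschitz_free ::
  "'a lipschitz_free \<Rightarrow> 'a lipschitz_free \<Rightarrow> 'a lipschitz_free" is "(-)"
  by (rule subspace_diff[OF subspace_closure_span])

lift_definition scaleR_lipschitz_free ::
  "real \<Rightarrow> 'a lipschitz_free \<Rightarrow> 'a lipschitz_free" is "(*\<^sub>R)"
  by (rule subspace_scale[OF subspace_closure_span])

lift_definition norm_lipschitz_free :: "'a lipschitz_free \<Rightarrow> real" is norm .

definition dist_lipschitz_free :: "'a lipschitz_free \<Rightarrow> 'a lipschitz_free \<Rightarrow> real" where
  "dist_lipschitz_free m n = norm (m - n)"

definition sgn_lipschitz_free :: "'a lipschitz_free \<Rightarrow> 'a lipschitz_free" where
  "sgn_lipschitz_free m = inverse (norm m) *\<^sub>R m"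

definition uniformity_lipschitz_free :: "('a lipschitz_free \<times> 'a lipschitz_free) filter" where
  "uniformity_lipschitz_free = (INF e\<in>{0<..}. principal {(m, n). dist m n < e})"

definition open_lipschitz_free :: "'a lipschitz_free set \<Rightarrow> bool" where
  "open_lipschitz_free S = (\<forall>m\<in>S. \<forall>\<^sub>F (m', n) in uniformity. m' = m \<longrightarrow> n \<in> S)"

instance
proof
  fix m n k :: "'a lipschitz_free" and a b :: real
  show "m + n + k = m + (n + k)" "m + n = n + m" "0 + m = m" "- m + m = 0" "m - n = m + - n"
    "a *\<^sub>R (m + n) = a *\<^sub>R m + a *\<^sub>R n" "(a + b) *\<^sub>R m = a *\<^sub>R m + b *\<^sub>R m"
    "a *\<^sub>R b *\<^sub>R m = (a * b) *\<^sub>R m" "1 *\<^sub>R m = m"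
    by (transfer; simp add: scaleR_add_right scaleR_add_left)+
  show "dist m n = norm (m - n)" "sgn m = inverse (norm m) *\<^sub>R m"
    by (simp_all add: dist_lipschitz_free_def sgn_lipschitz_free_def)
  show "(uniformity :: ('a lipschitz_free \<times> 'a lipschitz_free) filter)
      = (INF e\<in>{0<..}. principal {(m, n). dist m n < e})"
    by (rule uniformity_lipschitz_free_def)
  show "open S = (\<forall>m\<in>S. \<forall>\<^sub>F (m', n) in uniformity. m' = m \<longrightarrow> n \<in> S)"
    for S :: "'a lipschitz_free set"
    by (rule open_lipschitz_free_def)
  show "norm m = 0 \<longleftrightarrow> m = 0" "norm (a *\<^sub>R m) = \<bar>a\<bar> * norm m"
    by (transfer; simp)+
  show "norm (m + n) \<le> norm m + norm n"
    by transfer (rule norm_triangle_ineq)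
qed

end


section \<open>Complementation in the bidual\<close>

lift_definition bidual_embedding ::
  "'x::real_normed_vector \<Rightarrow> ('x \<Rightarrow>\<^sub>L real) \<Rightarrow>\<^sub>L real" is "\<lambda>x f. blinfun_apply f x"
  by (rule blinfun.bounded_linear_left)

definition one_complemented_in_bidual :: "'x::real_normed_vector itself \<Rightarrow> bool" where
  "one_complemented_in_bidual _ \<longleftrightarrow>
    (\<exists>P :: (('x \<Rightarrow>\<^sub>L real) \<Rightarrow>\<^sub>L real) \<Rightarrow>\<^sub>L (('x \<Rightarrow>\<^sub>L real) \<Rightarrow>\<^sub>L real).
      (\<forall>\<phi>. blinfun_apply P (blinfun_apply P \<phi>) = blinfun_apply P \<phi>) \<and>
      range (blinfun_apply P) = range (bidual_embedding :: 'x \<Rightarrow> _) \<and>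
      norm P \<le> 1)"


section \<open>Ultrametric spaces\<close>

class ultrametric_space = metric_space +
  assumes ultrametric: "dist x y \<le> max (dist x z) (dist z y)"

text \<open>Both open and closed balls are admitted, also mixed in one sequence. In an ultrametric space
  the condition is the same whichever kind of ball is used.\<close>

definition is_metric_ball :: "'a::metric_space set \<Rightarrow> bool" where
  "is_metric_ball B \<longleftrightarrow> (\<exists>x r. 0 < r \<and> (B = ball x r \<or> B = cball x r))"

definition spherically_complete :: "'a::metric_space itself \<Rightarrow> bool" where
  "spherically_complete _ \<longleftrightarrow>
    (\<forall>A :: nat \<Rightarrow> 'a set.
      (\<forall>n. is_metric_ball (A n)) \<and> (\<forall>n. A (Suc n) \<subseteq> A n) \<longrightarrow> (\<Inter>n. A n) \<noteq> {})"

end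

theory Submission
  imports Defs
begin

text \<open>
  Suppose that nested balls \<open>A n\<close> in a complete ultrametric space \<open>M\<close> have empty intersection, and
  pick \<open>x n \<in> A n\<close>. Seen from a point \<open>y\<close>, the \<open>x n\<close> are eventually all at the same distance
  \<open>\<rho> y\<close>, as if they converged to a point that \<open>M\<close> lacks. The infimum \<open>r\<close> of \<open>\<rho>\<close> is positive,
  because otherwise the \<open>x n\<close> would converge, and it is not attained (\<open>missing_point\<close>).

  A cluster point \<open>\<phi>\<close> of the \<open>\<delta>(x n)\<close> in the weak-star topology of the bidual is within \<open>\<rho> y\<close> of every
  \<open>\<delta> y\<close>. A projection of norm at most 1 onto the canonical image fixes the \<open>\<delta> y\<close>, so it carries
  \<open>\<phi>\<close> to an element \<open>m\<close> of the free space with \<open>\<parallel>m - \<delta> y\<parallel> \<le> \<rho> y\<close> for all \<open>y\<close>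
  (\<open>one_complemented_limit_point\<close>).

  No such \<open>m\<close> exists (\<open>no_free_element_at_missing_point\<close>). Points on different levels of \<open>\<rho>\<close> are
  at distance at least the larger level, so \<open>y \<mapsto> g (\<rho> y)\<close> is 1-Lipschitz as soon as
  \<open>\<bar>g s\<bar> \<le> s / 2\<close>. Think of \<open>m\<close> as a signed measure of total mass 1 and
  let \<open>b s\<close> be its mass on the level \<open>s\<close>. The choice \<open>g s = s / 2\<close> where \<open>b s > 0\<close> and
  \<open>g s = - s / 2\<close> elsewhere gives \<open>\<parallel>m - \<delta> y\<parallel> \<ge> (\<Sum>s. \<bar>b s\<bar> * s) / 2 + \<rho> y / 2\<close> for a point \<open>y\<close> whose
  level carries no mass. Let \<open>\<rho> y\<close> decrease to \<open>r\<close>: the left-hand side is at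
  most \<open>\<rho> y\<close>, so \<open>(\<Sum>s. \<bar>b s\<bar> * s) \<le> r\<close>. But all levels \<open>s\<close> exceed \<open>r\<close> and the total mass is 1, so
  this sum is greater than \<open>r\<close>. As \<open>m\<close> is only a limit of finitely supported
  measures, the proof first finds a level \<open>t > r\<close> beyond which at least half of the mass must stay;
  this gives a gap that survives a sufficiently fine approximation.
\<close>

section \<open>Limits of bounded sequences in the bidual\<close>

text \<open>
  The functional is a weak-star cluster point of the sequence, and it exists because, by
  Tychonoff's theorem, a product of compact intervals is compact. A bound on the distance to \<open>x\<close>
  that holds for all late terms passes to the cluster point.
\<close>

lemma exists_limit_functional:
  fixes u :: "nat \<Rightarrow> 'x::real_normed_vector"
  assumes bounded: "\<forall>\<^sub>F n in sequentially. norm (u n) \<le> C"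
  obtains \<phi> :: "('x \<Rightarrow>\<^sub>L real) \<Rightarrow>\<^sub>L real"
  where "\<And>x r. \<forall>\<^sub>F n in sequentially. norm (u n - x) \<le> r \<Longrightarrow> norm (\<phi> - bidual_embedding x) \<le> r"
proof -
  define K :: "(('x \<Rightarrow>\<^sub>L real) \<Rightarrow> real) set" where "K = (\<Pi>\<^sub>E f\<in>UNIV. cball 0 (norm f * C))"
  define F :: "(('x \<Rightarrow>\<^sub>L real) \<Rightarrow> real) filter" where "F = filtermap (\<lambda>n f. blinfun_apply f (u n)) sequentially"
  have "compactin (product_topology (\<lambda>_. euclidean) UNIV) K"
    unfolding K_def by (subst compactin_PiE) auto
  then have "compact K"
    by (simp add: euclidean_product_topology)
  moreover have "F \<noteq> bot"
    by (simp add: F_def filtermap_bot_iff)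
  moreover have "\<forall>\<^sub>F \<psi> in F. \<psi> \<in> K"
  proof -
    have "\<forall>\<^sub>F n in sequentially. \<forall>f. \<bar>blinfun_apply f (u n)\<bar> \<le> norm f * C"
      using bounded
    proof eventually_elim
      case (elim n)
      show ?case
      proof
        fix f :: "'x \<Rightarrow>\<^sub>L real"
        have "\<bar>f (u n)\<bar> \<le> norm f * norm (u n)"
          using norm_blinfun[of f "u n"] by simp
        also have "\<dots> \<le> norm f * C"
          using elim by (intro mult_left_mono) auto
        finally show "\<bar>f (u n)\<bar> \<le> norm f * C" .
      qed
    qed
    then show ?thesis
      by (simp add: F_def eventually_filtermap K_def PiE_iff)
  qed
  ultimately obtain \<psi> where "\<psi> \<in> K" and G_bot: "inf (nhds \<psi>) F \<noteq> bot"
    unfolding compact_filter by blast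
  \<comment> \<open>Along the filter \<open>G\<close> evaluation at each functional converges, while every statement about
    almost all terms of the sequence still holds eventually.\<close>
  define G where "G = inf (nhds \<psi>) F"
  have G: "G \<noteq> bot" and GF: "G \<le> F" and "G \<le> nhds \<psi>"
    using G_bot by (simp_all add: G_def)
  have eventually_G: "\<forall>\<^sub>F \<theta> in G. R \<theta>" if "\<forall>\<^sub>F n in sequentially. R (\<lambda>f. blinfun_apply f (u n))" for R
    using that GF by (simp add: F_def eventually_filtermap filter_leD)
  have lim: "((\<lambda>\<theta>. \<theta> f) \<longlongrightarrow> \<psi> f) G" for f
  proof -
    have "continuous_on UNIV (\<lambda>\<theta> :: ('x \<Rightarrow>\<^sub>L real) \<Rightarrow> real. \<theta> f)"
      by (rule continuous_on_product_coordinates)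
    then have "((\<lambda>\<theta>. \<theta> f) \<longlongrightarrow> \<psi> f) (at \<psi>)"
      by (simp add: continuous_on_def)
    then have "((\<lambda>\<theta>. \<theta> f) \<longlongrightarrow> \<psi> f) (nhds \<psi>)"
      using tendsto_at_iff_tendsto_nhds[of "\<lambda>\<theta>. \<theta> f" \<psi>] by simp
    then show ?thesis
      using \<open>G \<le> nhds \<psi>\<close> by (rule tendsto_mono[rotated])
  qed
  have "bounded_linear \<psi>"
  proof (rule bounded_linear_intro)
    fix f g
    have "((\<lambda>\<theta>. \<theta> (f + g)) \<longlongrightarrow> \<psi> f + \<psi> g) G"
    proof (rule Lim_transform_eventually)
      show "((\<lambda>\<theta>. \<theta> f + \<theta> g) \<longlongrightarrow> \<psi> f + \<psi> g) G"
        by (intro tendsto_add lim)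
      show "\<forall>\<^sub>F \<theta> in G. \<theta> f + \<theta> g = \<theta> (f + g)"
        by (rule eventually_G) (simp add: blinfun.add_left)
    qed
    with lim show "\<psi> (f + g) = \<psi> f + \<psi> g"
      by (rule tendsto_unique[OF G])
  next
    fix c f
    have "((\<lambda>\<theta>. \<theta> (c *\<^sub>R f)) \<longlongrightarrow> c *\<^sub>R \<psi> f) G"
    proof (rule Lim_transform_eventually)
      show "((\<lambda>\<theta>. c *\<^sub>R \<theta> f) \<longlongrightarrow> c *\<^sub>R \<psi> f) G"
        by (intro tendsto_scaleR tendsto_const lim)
      show "\<forall>\<^sub>F \<theta> in G. c *\<^sub>R \<theta> f = \<theta> (c *\<^sub>R f)"
        by (rule eventually_G) (simp add: blinfun.scaleR_left)
    qed
    with lim show "\<psi> (c *\<^sub>R f) = c *\<^sub>R \<psi> f"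
      by (rule tendsto_unique[OF G])
  next
    fix f
    show "norm (\<psi> f) \<le> norm f * C"
      using \<open>\<psi> \<in> K\<close> by (simp add: K_def PiE_iff)
  qed
  then obtain \<phi> where \<phi>: "\<psi> = blinfun_apply \<phi>"
    using bounded_linear_Blinfun_apply by metis
  show thesis
  proof (rule that)
    fix x :: 'x and r :: real
    assume r: "\<forall>\<^sub>F n in sequentially. norm (u n - x) \<le> r"
    then obtain n where "norm (u n - x) \<le> r"
      by (auto dest: eventually_happens)
    then have "0 \<le> r"
      using norm_ge_zero order_trans by blast
    show "norm (\<phi> - bidual_embedding x) \<le> r"
    proof (rule norm_blinfun_bound[OF \<open>0 \<le> r\<close>])
      fix f :: "'x \<Rightarrow>\<^sub>L real"
      have "\<bar>\<psi> f - f x\<bar> \<le> r * norm f"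
      proof (rule tendsto_upperbound[OF _ _ G])
        show "((\<lambda>\<theta>. \<bar>\<theta> f - f x\<bar>) \<longlongrightarrow> \<bar>\<psi> f - f x\<bar>) G"
          by (intro tendsto_intros lim)
        show "\<forall>\<^sub>F \<theta> in G. \<bar>\<theta> f - f x\<bar> \<le> r * norm f"
        proof (rule eventually_G)
          show "\<forall>\<^sub>F n in sequentially. \<bar>f (u n) - f x\<bar> \<le> r * norm f"
            using r
          proof eventually_elim
            case (elim n)
            have "\<bar>f (u n) - f x\<bar> \<le> norm f * norm (u n - x)"
              using norm_blinfun[of f "u n - x"] by (simp add: blinfun.diff_right)
            also have "\<dots> \<le> norm f * r"
              using elim by (intro mult_left_mono) auto
            finally show ?case
              by (simp add: mult.commute)
          qed
        qed
      qed
      then show "norm ((\<phi> - bidual_embedding x) f) \<le> r * norm f"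
        by (simp add: \<phi> blinfun.diff_left bidual_embedding.rep_eq)
    qed
  qed
qed

text \<open>
  The norm-one projection moves the cluster point of the sequence back into the space without
  increasing its distance to any point of the space.
\<close>

lemma one_complemented_limit_point:
  fixes u :: "nat \<Rightarrow> 'x::real_normed_vector"
  assumes "one_complemented_in_bidual TYPE('x)"
    and "\<forall>\<^sub>F n in sequentially. norm (u n) \<le> C"
  obtains m :: 'x
  where "\<And>x r. \<forall>\<^sub>F n in sequentially. norm (u n - x) \<le> r \<Longrightarrow>
    norm (bidual_embedding m - bidual_embedding x) \<le> r"
proof -
  obtain \<phi> where \<phi>: "\<And>x r. \<forall>\<^sub>F n in sequentially. norm (u n - x) \<le> r \<Longrightarrow>
      norm (\<phi> - bidual_embedding x) \<le> r"
    using exists_limit_functional[OF assms(2)] by blast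
  obtain P :: "(('x \<Rightarrow>\<^sub>L real) \<Rightarrow>\<^sub>L real) \<Rightarrow>\<^sub>L (('x \<Rightarrow>\<^sub>L real) \<Rightarrow>\<^sub>L real)"
    where idem: "\<And>\<theta>. P (P \<theta>) = P \<theta>"
      and range: "range P = range bidual_embedding" and "norm P \<le> 1"
    using assms(1) unfolding one_complemented_in_bidual_def by blast
  have "P \<phi> \<in> range bidual_embedding"
    by (simp flip: range)
  then obtain m where m: "P \<phi> = bidual_embedding m"
    by blast
  have fixed: "P (bidual_embedding x) = bidual_embedding x" for x
  proof -
    have "bidual_embedding x \<in> range P"
      by (simp add: range)
    then show ?thesis
      using idem by auto
  qed
  show thesis
  proof (rule that)
    fix x r assume "\<forall>\<^sub>F n in sequentially. norm (u n - x) \<le> r"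
    have "norm (bidual_embedding m - bidual_embedding x) = norm (P (\<phi> - bidual_embedding x))"
      by (simp add: blinfun.diff_right m fixed)
    also have "\<dots> \<le> norm P * norm (\<phi> - bidual_embedding x)"
      by (rule norm_blinfun)
    also have "\<dots> \<le> 1 * norm (\<phi> - bidual_embedding x)"
      using \<open>norm P \<le> 1\<close> by (intro mult_right_mono) auto
    also have "\<dots> \<le> r"
      using \<phi> \<open>\<forall>\<^sub>F n in sequentially. norm (u n - x) \<le> r\<close> by simp
    finally show "norm (bidual_embedding m - bidual_embedding x) \<le> r" .
  qed
qed


section \<open>Norms and finite approximations in the Lipschitz-free space\<close>

lift_definition free_delta :: "'a::pointed_metric_space \<Rightarrow> 'a lipschitz_free" is delta
  by (meson closure_subset rangeI span_base subsetD)

lemma delta_base_point: "delta (base_point :: 'a::pointed_metric_space) = 0"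
proof (rule blinfun_eqI)
  fix f :: "'a lip0"
  show "delta base_point f = blinfun_apply 0 f"
    using lip0_apply[of f] by (simp add: delta.rep_eq)
qed

lemma norm_delta_diff_le: "norm (delta x - delta y) \<le> dist x y"
  by (rule norm_blinfun_bound)
    (use lip0_upper in \<open>auto simp: blinfun.diff_left delta.rep_eq mult.commute\<close>)

text \<open>
  That the canonical embedding does not shrink norms is here elementary: every Lipschitz function
  \<open>g\<close> acts on the free space by evaluation, with norm at most that of \<open>g\<close>, and these functionals
  determine the norm.
\<close>

lemma norm_free_functional_le:
  fixes m :: "'a::pointed_metric_space lipschitz_free"
  shows "norm (free_functional m) \<le> norm (bidual_embedding m)"
proof (rule norm_blinfun_bound)
  fix g :: "'a lip0"
  have le: "\<bar>free_functional k g\<bar> \<le> norm k * norm g" for k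
    using norm_blinfun[of "free_functional k" g] by (simp add: norm_lipschitz_free.rep_eq)
  have lin: "bounded_linear (\<lambda>k. free_functional k g)"
    by (rule bounded_linear_intro)
      (use le in \<open>auto simp: plus_lipschitz_free.rep_eq scaleR_lipschitz_free.rep_eq
        blinfun.add_left blinfun.scaleR_left\<close>)
  define G where "G = Blinfun (\<lambda>k. free_functional k g)"
  have G: "G k = free_functional k g" for k
    by (simp add: G_def bounded_linear_Blinfun_apply[OF lin])
  have "norm G \<le> norm g"
    by (rule norm_blinfun_bound) (use le in \<open>auto simp: G mult.commute\<close>)
  have "norm (free_functional m g) = norm (bidual_embedding m G)"
    by (simp add: bidual_embedding.rep_eq G)
  also have "\<dots> \<le> norm (bidual_embedding m) * norm G"
    by (rule norm_blinfun)
  also have "\<dots> \<le> norm (bidual_embedding m) * norm g"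
    using \<open>norm G \<le> norm g\<close> by (intro mult_left_mono) auto
  finally show "norm (free_functional m g) \<le> norm (bidual_embedding m) * norm g" .
qed simp

text \<open>
  As \<open>\<delta>\<close> vanishes at the base point, its coefficient there can be chosen to make the
  total mass 1. Then pairing with a function that has been shifted to vanish at the base point
  changes only by a constant.
\<close>

lemma span_delta_affine:
  assumes "m \<in> span (range delta)"
  obtains I and a :: "'a::pointed_metric_space \<Rightarrow> real"
  where "finite I" "base_point \<in> I" "sum a I = 1" "m = (\<Sum>y\<in>I. a y *\<^sub>R delta y)"
proof -
  obtain T c where T: "finite T" "T \<subseteq> range delta" and m: "m = (\<Sum>v\<in>T. c v *\<^sub>R v)"
    using assms unfolding span_explicit by blast
  obtain J where J: "inj_on delta J" "T = delta ` J"
    using T(2) subset_image_inj by metis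
  have "finite J"
    using T J by (simp add: finite_image_iff)
  define J' where "J' = J - {base_point}"
  define a where "a y = (if y = base_point then 1 - (\<Sum>y\<in>J'. c (delta y)) else c (delta y))" for y
  have fin: "finite J'" and notin: "base_point \<notin> J'"
    using \<open>finite J\<close> by (auto simp: J'_def)
  have a: "sum a J' = (\<Sum>y\<in>J'. c (delta y))"
    "(\<Sum>y\<in>J'. a y *\<^sub>R delta y) = (\<Sum>y\<in>J'. c (delta y) *\<^sub>R delta y)"
    by (rule sum.cong; use notin in \<open>auto simp: a_def\<close>)+
  have "m = (\<Sum>y\<in>J. c (delta y) *\<^sub>R delta y)"
    by (simp add: m J sum.reindex)
  also have "\<dots> = (\<Sum>y\<in>J'. c (delta y) *\<^sub>R delta y)"
    by (rule sum.mono_neutral_right) (use \<open>finite J\<close> in \<open>auto simp: J'_def delta_base_point\<close>)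
  finally have "m = (\<Sum>y\<in>insert base_point J'. a y *\<^sub>R delta y)"
    using fin notin by (simp add: a delta_base_point)
  moreover have "sum a (insert base_point J') = 1"
    using fin notin by (simp add: a) (simp add: a_def)
  ultimately show thesis
    using fin that by blast
qed


section \<open>Functions of the distance to a missing point\<close>

text \<open>
  On different levels \<open>s\<close> and \<open>s'\<close> the values of \<open>g\<close> differ by at most
  \<open>(s + s') / 2 \<le> max s s'\<close>, which the distance of the points dominates.
\<close>

lemma radial_lip0:
  fixes \<rho> :: "'a::pointed_metric_space \<Rightarrow> real"
  assumes sep: "\<And>y z. \<rho> y \<noteq> \<rho> z \<Longrightarrow> max (\<rho> y) (\<rho> z) \<le> dist y z"
    and g: "\<And>y. \<bar>g (\<rho> y)\<bar> \<le> \<rho> y / 2"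
  obtains f where "norm f \<le> 1" "\<And>y. lip0_apply f y = g (\<rho> y) - g (\<rho> base_point)"
proof -
  have *: "\<bar>g (\<rho> y) - g (\<rho> z)\<bar> \<le> dist y z" for y z
    using sep[of y z] g[of y] g[of z] by (cases "\<rho> y = \<rho> z") auto
  define f where "f = Abs_lip0 (\<lambda>y. g (\<rho> y) - g (\<rho> base_point))"
  have f: "lip0_apply f = (\<lambda>y. g (\<rho> y) - g (\<rho> base_point))"
    unfolding f_def
    by (rule Abs_lip0_inverse) (use * in \<open>auto intro!: exI[of _ 1] lipschitz_onI simp: dist_real_def\<close>)
  have "norm f \<le> 1"
    by (rule lip0_least) (use * in \<open>auto simp: f\<close>)
  then show thesis
    using f that by simp
qed

text \<open>
  The sign must depend only on the level \<open>\<rho> y\<close>, since points on one level may be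
  close to each other. After collecting the coefficients of each level into \<open>b s\<close>, the right-hand
  side is \<open>\<Sum>s. \<bar>b s\<bar> * s\<close>, which dominates \<open>\<Sum>s. b s * w s\<close> term by term.
\<close>

lemma sum_le_sign_sum:
  fixes a \<rho> :: "'a \<Rightarrow> real" and w :: "real \<Rightarrow> real"
  assumes "finite I" and w: "\<And>y. y \<in> I \<Longrightarrow> 0 \<le> w (\<rho> y) \<and> w (\<rho> y) \<le> \<rho> y"
  defines "\<sigma> \<equiv> \<lambda>s. if 0 < (\<Sum>y | y \<in> I \<and> \<rho> y = s. a y) then 1 else - 1 :: real"
  shows "(\<Sum>y\<in>I. a y * w (\<rho> y)) \<le> (\<Sum>y\<in>I. a y * (\<sigma> (\<rho> y) * \<rho> y))"
proof -
  define b where "b s = (\<Sum>y | y \<in> I \<and> \<rho> y = s. a y)" for s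
  have group: "(\<Sum>y\<in>I. a y * h (\<rho> y)) = (\<Sum>s\<in>\<rho> ` I. b s * h s)" for h :: "real \<Rightarrow> real"
    by (subst sum.image_gen[OF \<open>finite I\<close>, where g = \<rho>]) (simp add: b_def sum_distrib_right)
  have "b s * w s \<le> b s * (\<sigma> s * s)" if "s \<in> \<rho> ` I" for s
  proof (cases "0 < b s")
    case True
    then show ?thesis
      using w that by (auto simp: \<sigma>_def b_def intro!: mult_left_mono)
  next
    case False
    then have "b s * w s \<le> 0" "0 \<le> b s * (- s)"
      using w that by (force intro: mult_nonpos_nonneg mult_nonpos_nonpos)+
    with False show ?thesis
      by (simp add: \<sigma>_def b_def)
  qed
  then show ?thesis
    unfolding group group[of "\<lambda>s. \<sigma> s * s"] by (rule sum_mono)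
qed

text \<open>
  The idea is that transporting mass 1 from \<open>m\<close> to a point \<open>y\<close> with \<open>\<rho> y\<close> close to \<open>r\<close> costs
  strictly more than \<open>r\<close>, by an amount that does not shrink as \<open>\<rho> y\<close> tends to \<open>r\<close>.
\<close>

lemma no_free_element_at_missing_point:
  fixes \<rho> :: "'a::pointed_metric_space \<Rightarrow> real"
  assumes sep: "\<And>y z. \<rho> y \<noteq> \<rho> z \<Longrightarrow> max (\<rho> y) (\<rho> z) \<le> dist y z"
    and "0 < r" and above: "\<And>y. r < \<rho> y" and inf: "\<And>e. 0 < e \<Longrightarrow> \<exists>y. \<rho> y < r + e"
    and m: "m \<in> closure (span (range delta))"
    and near: "\<And>y. norm (m - delta y) \<le> \<rho> y"
  shows False
proof -
  have approx: "\<exists>I a. finite I \<and> base_point \<in> I \<and> sum a I = 1 \<and>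
      norm (m - (\<Sum>y\<in>I. a y *\<^sub>R delta y)) < e" if "0 < e" for e
  proof -
    obtain m' where "m' \<in> span (range delta)" "dist m' m < e"
      using m \<open>0 < e\<close> by (meson closure_approachable)
    then show ?thesis
      by (metis span_delta_affine dist_norm dist_commute)
  qed
  have pairing: "(\<Sum>y\<in>I. a y *\<^sub>R delta y) f = (\<Sum>y\<in>I. a y * h y) - h base_point"
    if "sum a I = 1" and "\<And>y. lip0_apply f y = h y - h base_point" for I a f and h :: "'a \<Rightarrow> real"
  proof -
    have "(\<Sum>y\<in>I. a y *\<^sub>R delta y) f = (\<Sum>y\<in>I. a y * h y - a y * h base_point)"
      by (simp add: blinfun.sum_left blinfun.scaleR_left delta.rep_eq that(2) right_diff_distrib)
    also have "\<dots> = (\<Sum>y\<in>I. a y * h y) - sum a I * h base_point"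
      by (simp add: sum_subtractf sum_distrib_right)
    finally show ?thesis
      using that(1) by simp
  qed
  have test: "\<bar>\<theta> f\<bar> \<le> norm \<theta>" if "norm f \<le> 1" for f and \<theta> :: "'a lip0 \<Rightarrow>\<^sub>L real"
    using norm_blinfun[of \<theta> f] mult_left_le[OF that norm_ge_zero[of \<theta>]] by simp

  \<comment> \<open>A coarse approximation supported on levels at or above some \<open>t > r\<close> shows that \<open>m\<close> has little
    mass below \<open>t\<close>. The function \<open>U\<close> measures this: it is 0 at or above \<open>t\<close> and \<open>- r / 2\<close> below.\<close>
  obtain I0 a0 where I0: "finite I0" "base_point \<in> I0" and a0: "sum a0 I0 = 1"
    and m0: "norm (m - (\<Sum>y\<in>I0. a0 y *\<^sub>R delta y)) < r / 8"
    using approx[of "r / 8"] \<open>0 < r\<close> by auto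
  define t where "t = Min (\<rho> ` I0)"
  have t: "t \<le> \<rho> y" if "y \<in> I0" for y
    using that I0 by (simp add: t_def)
  have "r < t"
    unfolding t_def using I0 above by (subst Min_gr_iff) auto
  define u :: "real \<Rightarrow> real" where "u s = (if t \<le> s then r / 2 else 0)" for s
  have u: "\<bar>u (\<rho> y)\<bar> \<le> \<rho> y / 2" for y
    using \<open>0 < r\<close> above[of y] by (auto simp: u_def)
  obtain U where "norm U \<le> 1" and U: "\<And>y. lip0_apply U y = u (\<rho> y) - u (\<rho> base_point)"
    using radial_lip0[of \<rho> u, OF sep u] by blast
  have "(\<Sum>y\<in>I0. a0 y *\<^sub>R delta y) U = (\<Sum>y\<in>I0. 0 :: real)"
    unfolding blinfun.sum_left
    by (rule sum.cong) (use t I0 in \<open>auto simp: blinfun.scaleR_left delta.rep_eq U u_def\<close>)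
  then have mU: "\<bar>m U\<bar> \<le> r / 8"
    using test[OF \<open>norm U \<le> 1\<close>, of "m - (\<Sum>y\<in>I0. a0 y *\<^sub>R delta y)"] m0
    by (simp add: blinfun.diff_left)

  \<comment> \<open>A second approximation, fine compared to \<open>t - r\<close>. Its mass at or above \<open>t\<close> is at least 1/2,
    which will produce a gap of \<open>(t - r) / 4\<close>; against it stand two errors of size at most \<open>e\<close>.\<close>
  define e where "e = min (r / 8) ((t - r) / 16)"
  have "0 < e" "e \<le> r / 8" "e \<le> (t - r) / 16"
    unfolding e_def using \<open>0 < r\<close> \<open>r < t\<close> by (simp_all only: min.cobounded1 min.cobounded2) simp
  obtain I a where I: "finite I" and a: "sum a I = 1"
    and m': "norm (m - (\<Sum>y\<in>I. a y *\<^sub>R delta y)) < e"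
    using approx[OF \<open>0 < e\<close>] by auto
  define m' where "m' = (\<Sum>y\<in>I. a y *\<^sub>R delta y)"
  have "I \<noteq> {}"
    using a by auto
  have "u (\<rho> base_point) = r / 2"
    using t I0 by (simp add: u_def)
  then have m'U: "m' U = (\<Sum>y\<in>I. a y * u (\<rho> y)) - r / 2"
    using pairing[of a I U "\<lambda>y. u (\<rho> y)", OF a U] by (simp add: m'_def)
  have "\<bar>m U - m' U\<bar> < e"
    using test[OF \<open>norm U \<le> 1\<close>, of "m - m'"] m' by (simp add: blinfun.diff_left m'_def)
  with mU m'U \<open>e \<le> r / 8\<close> have mass: "r / 4 \<le> (\<Sum>y\<in>I. a y * u (\<rho> y))"
    by linarith

  \<comment> \<open>The signed test function, compared with the lower bound \<open>w\<close> for the levels, which equals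
    \<open>r\<close> below \<open>t\<close> and \<open>t\<close> from there on.\<close>
  define \<sigma> where "\<sigma> = (\<lambda>s. if 0 < (\<Sum>y | y \<in> I \<and> \<rho> y = s. a y) then 1 else - 1 :: real)"
  define g where "g s = \<sigma> s * s / 2" for s
  have g: "\<bar>g (\<rho> y)\<bar> \<le> \<rho> y / 2" for y
    using \<open>0 < r\<close> above[of y] by (auto simp: g_def \<sigma>_def)
  obtain f where "norm f \<le> 1" and f: "\<And>y. lip0_apply f y = g (\<rho> y) - g (\<rho> base_point)"
    using radial_lip0[of \<rho> g, OF sep g] by blast
  define w where "w s = (if t \<le> s then t else r)" for s
  have w: "w s = r + (t - r) * (2 / r) * u s" for s
    using \<open>0 < r\<close> by (simp add: w_def u_def field_simps)
  have "r + (t - r) / 2 = r + (t - r) * (2 / r) * (r / 4)"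
    using \<open>0 < r\<close> by simp
  also have "\<dots> \<le> r + (t - r) * (2 / r) * (\<Sum>y\<in>I. a y * u (\<rho> y))"
    using \<open>0 < r\<close> \<open>r < t\<close> mass by (intro add_left_mono mult_left_mono) auto
  also have "\<dots> = sum a I * r + (\<Sum>y\<in>I. a y * ((t - r) * (2 / r) * u (\<rho> y)))"
    unfolding a sum_distrib_left by (simp add: mult_ac)
  also have "\<dots> = (\<Sum>y\<in>I. a y * w (\<rho> y))"
    by (simp add: w distrib_left sum.distrib sum_distrib_right)
  also have "\<dots> \<le> (\<Sum>y\<in>I. a y * (\<sigma> (\<rho> y) * \<rho> y))"
    unfolding \<sigma>_def
    by (rule sum_le_sign_sum[OF I]) (use \<open>0 < r\<close> \<open>r < t\<close> above in \<open>auto simp: w_def less_imp_le\<close>)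
  also have "\<dots> = 2 * (\<Sum>y\<in>I. a y * g (\<rho> y))"
    by (simp add: g_def sum_distrib_left)
  finally have large: "r / 2 + (t - r) / 4 \<le> (\<Sum>y\<in>I. a y * g (\<rho> y))"
    by simp

  \<comment> \<open>A point \<open>x\<close> below all levels of the approximation: its level carries no mass, so there the
    sign is negative.\<close>
  define d where "d = min e (Min (\<rho> ` I) - r)"
  have "0 < d"
    using \<open>0 < e\<close> I \<open>I \<noteq> {}\<close> above by (auto simp: d_def)
  then obtain x where x: "\<rho> x < r + d"
    using inf by blast
  then have "\<rho> x < r + e" "\<rho> x < Min (\<rho> ` I)"
    unfolding d_def by linarith+
  then have "\<rho> x < \<rho> y" if "y \<in> I" for y
    using I that by (simp add: Min_gr_iff[OF finite_imageI] \<open>I \<noteq> {}\<close>)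
  then have empty: "{y. y \<in> I \<and> \<rho> y = \<rho> x} = {}"
    by fastforce
  then have gx: "g (\<rho> x) = - \<rho> x / 2"
    unfolding g_def \<sigma>_def empty by simp
  have "m' f - delta x f = (\<Sum>y\<in>I. a y * g (\<rho> y)) - g (\<rho> x)"
    using pairing[of a I f "\<lambda>y. g (\<rho> y)", OF a f] by (simp add: m'_def delta.rep_eq f)
  moreover have "\<bar>m f - delta x f\<bar> \<le> \<rho> x"
    using test[OF \<open>norm f \<le> 1\<close>, of "m - delta x"] near[of x] by (simp add: blinfun.diff_left)
  moreover have "\<bar>m f - m' f\<bar> < e"
    using test[OF \<open>norm f \<le> 1\<close>, of "m - m'"] m' by (simp add: blinfun.diff_left m'_def)
  ultimately show False
    using large gx \<open>\<rho> x < r + e\<close> \<open>e \<le> (t - r) / 16\<close> \<open>r < t\<close> by linarith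
qed


section \<open>Nested balls with empty intersection\<close>

text \<open>
  Every point of an ultrametric ball serves as its centre: two points of the ball are within the
  radius of each other, and a point outside is not within the radius of either.
\<close>

lemma dist_less_outside_ball:
  fixes u v y :: "'a::ultrametric_space"
  assumes "is_metric_ball B" "u \<in> B" "v \<in> B" "y \<notin> B"
  shows "dist u v < dist y u"
proof -
  obtain c R where B: "B = ball c R \<or> B = cball c R"
    using assms(1) unfolding is_metric_ball_def by blast
  have "dist u v \<le> max (dist c u) (dist c v)" "dist c y \<le> max (dist c u) (dist y u)"
    using ultrametric[of u v c] ultrametric[of c y u] by (simp_all add: dist_commute)
  with B assms(2-4) show ?thesis
    by auto
qed

lemma dist_eq_outside_ball:
  fixes u v y :: "'a::ultrametric_space"
  assumes "is_metric_ball B" "u \<in> B" "v \<in> B" "y \<notin> B"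
  shows "dist y u = dist y v"
  using dist_less_outside_ball[OF assms] dist_less_outside_ball[OF assms(1,3,2,4)]
    ultrametric[of y u v] ultrametric[of y v u] by (auto simp: dist_commute)

text \<open>
  Once \<open>y\<close> lies outside \<open>A N\<close>, the points of \<open>A N\<close> are all equally far from \<open>y\<close>, and closer
  to each other than to \<open>y\<close>. The first fact makes \<open>\<rho> y\<close> well defined; the second gives
  \<open>\<rho> (x n) < \<rho> y\<close> for \<open>n \<ge> N\<close>, so the infimum is not attained. If it were 0, then the sequence
  would be Cauchy, and \<open>\<rho>\<close> would vanish at its limit.
\<close>

lemma missing_point:
  fixes A :: "nat \<Rightarrow> 'a::{ultrametric_space, complete_space} set"
  assumes ball: "\<And>n. is_metric_ball (A n)" and nested: "\<And>n. A (Suc n) \<subseteq> A n"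
    and empty: "(\<Inter>n. A n) = {}"
  obtains x :: "nat \<Rightarrow> 'a" and \<rho> r where
    "\<And>y. \<forall>\<^sub>F n in sequentially. dist y (x n) = \<rho> y"
    "0 < r" "\<And>y. r < \<rho> y" "\<And>e. 0 < e \<Longrightarrow> \<exists>y. \<rho> y < r + e"
proof -
  have "A n \<noteq> {}" for n
    using ball[of n] unfolding is_metric_ball_def by fastforce
  then have "\<forall>n. \<exists>y. y \<in> A n"
    by blast
  then obtain x where x: "\<And>n. x n \<in> A n"
    by metis
  have mono: "x n \<in> A N" if "N \<le> n" for n N
    using x lift_Suc_antimono_le[of A, OF nested that] by blast
  have outside: "\<exists>N. y \<notin> A N" for y
    using empty by blast
  define \<rho> where "\<rho> y = dist y (x (SOME N. y \<notin> A N))" for y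
  have \<rho>: "dist y (x n) = \<rho> y" if "y \<notin> A N" "N \<le> n" for y n N
  proof -
    define K where "K = (SOME N. y \<notin> A N)"
    have "y \<notin> A K"
      unfolding K_def using outside by (rule someI_ex)
    then have "dist y (x K) = dist y (x (max K n))"
      using mono by (intro dist_eq_outside_ball[OF ball[of K]]) auto
    also have "\<dots> = dist y (x n)"
      using mono that by (intro dist_eq_outside_ball[OF ball[of N]]) auto
    finally show ?thesis
      by (simp add: \<rho>_def K_def)
  qed
  have ev: "\<forall>\<^sub>F n in sequentially. dist y (x n) = \<rho> y" for y
    using outside[of y] \<rho> unfolding eventually_sequentially by metis
  have less: "\<rho> (x n) < \<rho> y" if "y \<notin> A N" "N \<le> n" for y n N
  proof -
    obtain K where K: "x n \<notin> A K"
      using outside by blast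
    have "\<rho> (x n) = dist (x n) (x (max N K))"
      using \<rho>[OF K, of "max N K"] by simp
    also have "\<dots> < dist y (x n)"
      using that mono by (intro dist_less_outside_ball[OF ball[of N]]) auto
    finally show ?thesis
      using \<rho>[OF that] by simp
  qed
  have nonneg: "0 \<le> \<rho> y" for y
    by (simp add: \<rho>_def)
  define r where "r = Inf (range \<rho>)"
  have bdd: "bdd_below (range \<rho>)"
    using nonneg by (intro bdd_belowI[of _ 0]) auto
  have "r < \<rho> y" for y
  proof -
    obtain N where "y \<notin> A N"
      using outside by blast
    then have "\<rho> (x N) < \<rho> y"
      using less by blast
    moreover have "r \<le> \<rho> (x N)"
      unfolding r_def using bdd by (simp add: cInf_lower)
    ultimately show ?thesis
      by simp
  qed
  moreover have inf: "\<exists>y. \<rho> y < r + e" if "0 < e" for e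
    using cInf_lessD[of "range \<rho>" "r + e"] that by (auto simp: r_def)
  moreover have "0 < r"
  proof (rule ccontr)
    assume "\<not> 0 < r"
    have "Cauchy x"
      unfolding Cauchy_altdef2
    proof (intro allI impI)
      fix e :: real assume "0 < e"
      then obtain y where "\<rho> y < r + e"
        using inf by blast
      with \<open>\<not> 0 < r\<close> have "\<rho> y < e"
        by simp
      obtain N where N: "y \<notin> A N"
        using outside by blast
      have "dist (x n) (x N) < e" if "N \<le> n" for n
        using ultrametric[of "x n" "x N" y] \<rho>[OF N that] \<rho>[OF N order_refl] \<open>\<rho> y < e\<close>
        by (simp add: dist_commute)
      then show "\<exists>N. \<forall>n\<ge>N. dist (x n) (x N) < e"
        by blast
    qed
    then obtain z where "x \<longlonglongrightarrow> z"
      using Cauchy_convergent convergent_def by blast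
    then have "(\<lambda>n. dist z (x n)) \<longlonglongrightarrow> dist z z"
      by (intro tendsto_intros)
    moreover have "(\<lambda>n. dist z (x n)) \<longlonglongrightarrow> \<rho> z"
      by (rule tendsto_eventually[OF ev])
    ultimately have "\<rho> z = 0"
      using LIMSEQ_unique by fastforce
    moreover obtain N where "z \<notin> A N"
      using outside by blast
    ultimately show False
      using less[of z N N] nonneg[of "x N"] by simp
  qed
  ultimately show thesis
    using that ev by blast
qed

section \<open>Complemented free spaces force spherical completeness\<close>

theorem proposition3p1:
  assumes "one_complemented_in_bidual
    TYPE('a::{pointed_metric_space, ultrametric_space, complete_space} lipschitz_free)"
  shows "spherically_complete TYPE('a)"
proof (rule ccontr)
  assume "\<not> spherically_complete TYPE('a)"
  then obtain A :: "nat \<Rightarrow> 'a set" where "\<And>n. is_metric_ball (A n)" "\<And>n. A (Suc n) \<subseteq> A n"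
    "(\<Inter>n. A n) = {}"
    unfolding spherically_complete_def by blast
  then obtain x :: "nat \<Rightarrow> 'a" and \<rho> r where ev: "\<And>y. \<forall>\<^sub>F n in sequentially. dist y (x n) = \<rho> y"
    and r: "0 < r" "\<And>y. r < \<rho> y" "\<And>e. 0 < e \<Longrightarrow> \<exists>y. \<rho> y < r + e"
    using missing_point by metis
  have sep: "max (\<rho> y) (\<rho> z) \<le> dist y z" if "\<rho> y \<noteq> \<rho> z" for y z
  proof -
    have "\<forall>\<^sub>F n in sequentially. dist y (x n) = \<rho> y \<and> dist z (x n) = \<rho> z"
      using ev by (intro eventually_conj)
    then obtain n where "dist y (x n) = \<rho> y" "dist z (x n) = \<rho> z"
      by (auto dest: eventually_happens)
    then show ?thesis
      using that ultrametric[of y "x n" z] ultrametric[of z "x n" y] by (auto simp: dist_commute)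
  qed
  have delta_dist: "\<forall>\<^sub>F n in sequentially. norm (free_delta (x n) - free_delta y) \<le> \<rho> y" for y
    using ev[of y]
  proof eventually_elim
    case (elim n)
    then show ?case
      using norm_delta_diff_le[of "x n" y]
      by (simp add: norm_lipschitz_free.rep_eq minus_lipschitz_free.rep_eq free_delta.rep_eq
          dist_commute)
  qed
  have "free_delta base_point = (0 :: 'a lipschitz_free)"
    by transfer (rule delta_base_point)
  then have "\<forall>\<^sub>F n in sequentially. norm (free_delta (x n)) \<le> \<rho> base_point"
    using delta_dist[of base_point] by simp
  then obtain m :: "'a lipschitz_free" where m: "\<And>k s. \<forall>\<^sub>F n in sequentially. norm (free_delta (x n) - k) \<le> s \<Longrightarrow>
      norm (bidual_embedding m - bidual_embedding k) \<le> s"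
    using one_complemented_limit_point[OF assms] by metis
  have "norm (free_functional m - delta y) \<le> \<rho> y" for y
  proof -
    have "bidual_embedding (m - free_delta y) = bidual_embedding m - bidual_embedding (free_delta y)"
      by (rule blinfun_eqI) (simp add: blinfun.diff_left blinfun.diff_right bidual_embedding.rep_eq)
    then show ?thesis
      using norm_free_functional_le[of "m - free_delta y"] m[OF delta_dist[of y]]
      by (simp add: minus_lipschitz_free.rep_eq free_delta.rep_eq)
  qed
  then show False
    using no_free_element_at_missing_point[of \<rho> r, OF sep r free_functional] by blast
qed

end
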